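(* Let $n\ge 2$. A maximal (by size) arrangement of smallest positive minors in $Gr^{\ge}(2,n)$, and likewise a maximal (by size) arrangement of largest positive minors in $Gr^{\ge}(2,n)$, contains the following number of elements: $$\begin{cases}3m^2 & \text{if } n=3m,\\ m(3m+2) & \text{if } n=3m+1,\\ (m+1)(3m+1) & \text{if } n=3m+2.\end{cases}$$
   Context: The nonnegative Grassmannian $Gr^{\ge}(2,n)$ is the space of real $2\times n$ matrices of rank $2$, modulo row operations, whose $2\times 2$ minors $\Delta_{ij}$, $1\le i<j\le n$ (in columns $i,j$; defined up to a common nonzero factor), can be normalized so that $\Delta_{ij}\ge 0$ for all $i<j$; we always use such a normalization. Some Plücker coordinates $\Delta_{ij}$ are allowed to be zero. An arrangement of smallest (resp. largest) positive minors in $Gr^{\ge}(2,n)$ is a set $\mathcal{J}$ of two-element subsets of $\{1,\dots,n\}$ for which there is a point of $Gr^{\ge}(2,n)$ such that $\mathcal{J}$ is exactly the set of all $\{i,j\}$, $i<j$, for which $\Delta_{ij}$ is positive and equal to the smallest (resp. largest) value among all the positive $\Delta_{ab}$ at that point. "Maximal by size" means having the largest cardinality among all arrangements of the given type, over all points of $Gr^{\ge}(2,n)$. *)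

theory Defs
  imports "Jordan_Normal_Form.DL_Rank"
begin

text \<open>
  The Grassmannian of 2-planes in real n-space: real 2 x n matrices of rank 2 modulo row operations,
  i.e. modulo left multiplication by invertible 2 x 2 matrices. Its points are the equivalence
  classes themselves. In the library, \<^const>\<open>vec_space.rank\<close> takes the number of rows as an argument.
\<close>

definition full_rank_mats :: "nat \<Rightarrow> real mat set" where
  "full_rank_mats n = {A \<in> carrier_mat 2 n. vec_space.rank 2 A = 2}"

definition row_equiv :: "nat \<Rightarrow> (real mat \<times> real mat) set" where
  "row_equiv n = {(A, B). A \<in> full_rank_mats n \<and> B \<in> full_rank_mats n \<and>
     (\<exists>P \<in> carrier_mat 2 2. invertible_mat P \<and> B = P * A)}"

definition Gr2 :: "nat \<Rightarrow> real mat set set" where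
  "Gr2 n = full_rank_mats n // row_equiv n"

text \<open>
  Columns are numbered from 1, as in the mathematical notation, whereas \<^const>\<open>col\<close> counts from 0.
\<close>

definition minor :: "real mat \<Rightarrow> nat \<Rightarrow> nat \<Rightarrow> real" where
  "minor A i j = det (mat_of_cols 2 [col A (i - 1), col A (j - 1)])"

text \<open>
  Replacing A by P * A multiplies all minors by the nonzero number det P, and every nonzero factor
  arises in this way. Hence a normalization of the minors at a point is the choice of a
  representative; it is admissible if all minors of the representative are nonnegative.
\<close>

definition nonneg_minors :: "nat \<Rightarrow> real mat \<Rightarrow> bool" where
  "nonneg_minors n A \<longleftrightarrow> (\<forall>i j. 1 \<le> i \<and> i < j \<and> j \<le> n \<longrightarrow> minor A i j \<ge> 0)"

definition Gr2_nonneg :: "nat \<Rightarrow> real mat set set" where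
  "Gr2_nonneg n = {V \<in> Gr2 n. \<exists>A \<in> V. nonneg_minors n A}"

definition smallest_positive :: "nat \<Rightarrow> real mat \<Rightarrow> nat set set" where
  "smallest_positive n A = {{i, j} | i j. 1 \<le> i \<and> i < j \<and> j \<le> n \<and> minor A i j > 0 \<and>
     (\<forall>a b. 1 \<le> a \<and> a < b \<and> b \<le> n \<and> minor A a b > 0 \<longrightarrow> minor A i j \<le> minor A a b)}"

definition largest_positive :: "nat \<Rightarrow> real mat \<Rightarrow> nat set set" where
  "largest_positive n A = {{i, j} | i j. 1 \<le> i \<and> i < j \<and> j \<le> n \<and> minor A i j > 0 \<and>
     (\<forall>a b. 1 \<le> a \<and> a < b \<and> b \<le> n \<and> minor A a b > 0 \<longrightarrow> minor A a b \<le> minor A i j)}"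

definition smallest_arrangements :: "nat \<Rightarrow> nat set set set" where
  "smallest_arrangements n =
     {J. \<exists>V \<in> Gr2_nonneg n. \<exists>A \<in> V. nonneg_minors n A \<and> J = smallest_positive n A}"

definition largest_arrangements :: "nat \<Rightarrow> nat set set set" where
  "largest_arrangements n =
     {J. \<exists>V \<in> Gr2_nonneg n. \<exists>A \<in> V. nonneg_minors n A \<and> J = largest_positive n A}"

definition maximal_by_size :: "nat set set set \<Rightarrow> nat set set \<Rightarrow> bool" where
  "maximal_by_size \<A> J \<longleftrightarrow> J \<in> \<A> \<and> (\<forall>K \<in> \<A>. card K \<le> card J)"

end

theory Submission
  imports Defs
begin

text \<open>
  Both halves of the statement are Turan's theorem for graphs without a complete subgraph on four
  vertices, since all three numbers in it are the integer part of \<open>n\<^sup>2 / 3\<close>.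

  Regard an arrangement as the edge set of a graph on the columns \<open>1, \<dots>, n\<close>. All its minors have
  one common positive value \<open>c\<close>. If four columns \<open>i < j < k < l\<close> were pairwise joined, the
  Pluecker relation \<open>\<Delta>\<^sub>i\<^sub>k \<Delta>\<^sub>j\<^sub>l = \<Delta>\<^sub>i\<^sub>j \<Delta>\<^sub>k\<^sub>l + \<Delta>\<^sub>i\<^sub>l \<Delta>\<^sub>j\<^sub>k\<close> would read
  \<open>c\<^sup>2 = 2 c\<^sup>2\<close> (\<open>no_four_equal_minors\<close>). Hence the graph has no four pairwise joined
  vertices, and at most \<open>n\<^sup>2 / 3\<close> edges (\<open>turan\<close>). This bounds the arrangements of smallest and
  of largest minors alike.

  Conversely, Turan's extremal graph, the complete tripartite graph with three parts of almost equal
  size, is realised by three blocks of consecutive equal columns. Any two of the vectors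
  \<open>(1, 0)\<close>, \<open>(0, 1)\<close>, \<open>(-1, 1)\<close>, taken in this order, have determinant 1, so that every
  minor is 0 within a block and 1 between two blocks. The positive minors thus are all equal, and the
  graph is an arrangement of smallest and of largest minors at the same time.
\<close>

section \<open>Turan's theorem\<close>

definition clique :: "'a set set \<Rightarrow> 'a set \<Rightarrow> bool" where
  "clique E K \<longleftrightarrow> (\<forall>x\<in>K. \<forall>y\<in>K. x \<noteq> y \<longrightarrow> {x, y} \<in> E)"

text \<open>
  The edges are sorted by the number of their endpoints in \<open>K\<close>; each vertex outside a largest clique
  misses at least one vertex of that clique, as it could be added to the clique otherwise.
\<close>

lemma card_edges_le_largest_clique:
  assumes V: "finite V" and E: "E \<subseteq> {e. e \<subseteq> V \<and> card e = 2}"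
    and K: "K \<subseteq> V" "clique E K"
    and largest: "\<And>L. L \<subseteq> V \<Longrightarrow> clique E L \<Longrightarrow> card L \<le> card K"
  shows "card E \<le> (card K choose 2) + card (V - K) * (card K - 1) + card (E \<inter> Pow (V - K))"
proof -
  have fK: "finite K" using K V finite_subset by blast
  have fE: "finite E"
    using E V by (auto intro: finite_subset[of _ "Pow V"])
  define cross where "cross w = {{x, w} | x. x \<in> K \<and> {x, w} \<in> E}" for w
  have sub: "E \<subseteq> {e. e \<subseteq> K \<and> card e = 2} \<union> (\<Union>w\<in>V - K. cross w) \<union> (E \<inter> Pow (V - K))"
  proof
    fix e assume e: "e \<in> E"
    then obtain x y where xy: "e = {x, y}" "x \<noteq> y" "x \<in> V" "y \<in> V" "card e = 2"
      using E by (auto simp: card_2_iff)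
    consider "x \<in> K" "y \<in> K" | "x \<in> K" "y \<notin> K" | "x \<notin> K" "y \<in> K" | "x \<notin> K" "y \<notin> K"
      by blast
    then show "e \<in> {e. e \<subseteq> K \<and> card e = 2} \<union> (\<Union>w\<in>V - K. cross w) \<union> (E \<inter> Pow (V - K))"
    proof cases
      case 2
      then have "e \<in> cross y" using e xy by (auto simp: cross_def)
      then show ?thesis using 2 xy by blast
    next
      case 3
      then have "e \<in> cross x" using e xy by (auto simp: cross_def insert_commute)
      then show ?thesis using 3 xy by blast
    qed (use e xy in auto)
  qed
  have cross: "finite (cross w) \<and> card (cross w) \<le> card K - 1" if w: "w \<in> V - K" for w
  proof -
    have "\<not> clique E (insert w K)"
      using largest[of "insert w K"] w K fK by auto
    then obtain z where z: "z \<in> K" "{z, w} \<notin> E"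
      using K(2) unfolding clique_def by (metis insert_commute insert_iff)
    have im: "cross w \<subseteq> (\<lambda>x. {x, w}) ` (K - {z})"
      using z by (auto simp: cross_def)
    then have "card (cross w) \<le> card (K - {z})"
      using fK by (meson card_image_le card_mono finite_Diff finite_imageI le_trans)
    moreover have "finite (cross w)" using im fK finite_subset by blast
    ultimately show ?thesis using z fK by simp
  qed
  have fW: "finite (V - K)" using V by simp
  have "card E \<le> card ({e. e \<subseteq> K \<and> card e = 2} \<union> (\<Union>w\<in>V - K. cross w) \<union> (E \<inter> Pow (V - K)))"
    using sub fE fK fW cross by (intro card_mono) auto
  also have "\<dots> \<le> card {e. e \<subseteq> K \<and> card e = 2} + card (\<Union>w\<in>V - K. cross w)
      + card (E \<inter> Pow (V - K))"
    by (meson add_le_mono card_Un_le le_refl le_trans)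
  also have "card {e. e \<subseteq> K \<and> card e = 2} = card K choose 2"
    using n_subsets[OF fK] .
  also have "card (\<Union>w\<in>V - K. cross w) \<le> (\<Sum>w\<in>V - K. card (cross w))"
    using card_UN_le[OF fW] .
  also have "\<dots> \<le> card (V - K) * (card K - 1)"
    using sum_bounded_above[of "V - K" "\<lambda>w. card (cross w)" "card K - 1"] cross by simp
  finally show ?thesis by simp
qed

text \<open>
  Induction on the number of vertices: a largest clique \<open>K\<close> with \<open>k\<close> vertices is removed. As
  \<open>V - K\<close> has no larger clique, it has at most \<open>(k - 1) / (2 k) (|V| - k)\<^sup>2\<close> edges, and the edges
  meeting \<open>K\<close> complete this to \<open>(k - 1) / (2 k) |V|\<^sup>2\<close>, because
  \<open>k\<^sup>2 + 2 k (|V| - k) + (|V| - k)\<^sup>2 = |V|\<^sup>2\<close>. The bound \<open>r\<close> varies in the induction, since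
  the induction hypothesis is used for \<open>k\<close>; so graphs without a clique of exactly \<open>r\<close> vertices
  are not a special case.
\<close>

theorem turan:
  assumes "finite V" and "E \<subseteq> {e. e \<subseteq> V \<and> card e = 2}"
    and "\<And>K. K \<subseteq> V \<Longrightarrow> clique E K \<Longrightarrow> card K \<le> r"
  shows "2 * real r * real (card E) \<le> (real r - 1) * real (card V) ^ 2"
  using assms
proof (induction "card V" arbitrary: V E r rule: less_induct)
  case less
  note V = less.prems(1) and E = less.prems(2)
  show ?case
  proof (cases "V = {}")
    case True
    then have "E = {}" using E by auto
    then show ?thesis using True by simp
  next
    case False
    have fin: "finite {K. K \<subseteq> V \<and> clique E K}" using V by simp
    have ne: "{K. K \<subseteq> V \<and> clique E K} \<noteq> {}" by (auto simp: clique_def)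
    obtain K where K: "K \<subseteq> V" "clique E K"
      and largest: "\<And>L. L \<subseteq> V \<Longrightarrow> clique E L \<Longrightarrow> card L \<le> card K"
      using Max_in[of "card ` {K. K \<subseteq> V \<and> clique E K}"]
        Max_ge[of "card ` {K. K \<subseteq> V \<and> clique E K}"] fin ne
      by (smt (verit) finite_imageI image_iff image_is_empty mem_Collect_eq)
    define k where "k = card K"
    define w where "w = card (V - K)"
    obtain v where "v \<in> V" using False by blast
    then have k1: "k \<ge> 1" using largest[of "{v}"] by (simp add: clique_def k_def)
    have fK: "finite K" using K V finite_subset by blast
    have cV: "card V = w + k" using card_Diff_subset[OF fK K(1)] card_mono[OF V K(1)]
      by (simp add: k_def w_def)
    have "2 * real k * real (card (E \<inter> Pow (V - K))) \<le> (real k - 1) * real w ^ 2"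
      unfolding w_def
    proof (rule less.hyps)
      show "card (V - K) < card V" using cV k1 by (simp add: w_def)
      show "E \<inter> Pow (V - K) \<subseteq> {e. e \<subseteq> V - K \<and> card e = 2}" using E by auto
      show "card L \<le> k" if "L \<subseteq> V - K" "clique (E \<inter> Pow (V - K)) L" for L
        using largest[of L] that by (auto simp: clique_def k_def)
    qed (use V in simp)
    moreover have "real (card E) \<le> real k * (real k - 1) / 2 + real w * (real k - 1)
        + real (card (E \<inter> Pow (V - K)))"
    proof -
      have "even (k * (k - 1))" by (cases k) auto
      then have "2 * (k choose 2) = k * (k - 1)" by (simp add: choose_two)
      then have ch: "real (k choose 2) = real k * (real k - 1) / 2"
        using k1 by (metis (no_types, lifting) nonzero_mult_div_cancel_left of_nat_1 of_nat_diff
            of_nat_mult of_nat_numeral zero_neq_numeral)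
      have "real (card E) \<le> real ((k choose 2) + w * (k - 1) + card (E \<inter> Pow (V - K)))"
        using card_edges_le_largest_clique[OF V E K largest]
        unfolding k_def w_def by (simp only: of_nat_le_iff)
      then show ?thesis using k1 ch by (simp add: of_nat_diff)
    qed
    then have "2 * real k * real (card E) \<le> 2 * real k * (real k * (real k - 1) / 2
        + real w * (real k - 1) + real (card (E \<inter> Pow (V - K))))"
      by (intro mult_left_mono) auto
    moreover have "2 * real k * (real k * (real k - 1) / 2 + real w * (real k - 1))
        + (real k - 1) * real w ^ 2 = (real k - 1) * real (card V) ^ 2"
      unfolding cV by (simp add: field_simps power2_eq_square)
    ultimately have "2 * real k * real (card E) \<le> (real k - 1) * real (card V) ^ 2"
      by (simp only: distrib_left)
    \<comment> \<open>It remains to weaken the factor \<open>1 - 1 / k\<close> to \<open>1 - 1 / r\<close>.\<close>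
    then have "2 * real (card E) \<le> (1 - 1 / real k) * real (card V) ^ 2"
      using k1 by (simp add: field_simps)
    also have kr: "k \<le> r" using less.prems(3)[OF K] by (simp add: k_def)
    then have "(1 - 1 / real k) * real (card V) ^ 2 \<le> (1 - 1 / real r) * real (card V) ^ 2"
      using k1 by (intro mult_right_mono) (auto simp: frac_le)
    finally show ?thesis using k1 kr by (simp add: field_simps)
  qed
qed

section \<open>Equal minors span few edges\<close>

lemma minor_eq:
  "minor A i j = col A (i - 1) $ 0 * col A (j - 1) $ 1 - col A (j - 1) $ 0 * col A (i - 1) $ 1"
proof -
  let ?B = "mat_of_cols 2 [col A (i - 1), col A (j - 1)]"
  have B: "?B \<in> carrier_mat 2 2" by (auto simp: mat_of_cols_def)
  \<comment> \<open>Row \<open>1 - k\<close> is the row other than \<open>k\<close>.\<close>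
  have sub: "det (mat_delete ?B k 0) = ?B $$ (1 - k, 1)" if "k < 2" for k
  proof -
    have "mat_delete ?B k 0 \<in> carrier_mat 1 1"
      using mat_delete_carrier[OF B, of k 0] by simp
    from det_single[OF this] show ?thesis
      using that by (auto simp: mat_delete_def less_2_cases_iff)
  qed
  have "det ?B = (\<Sum>k<2. ?B $$ (k, 0) * cofactor ?B k 0)"
    by (rule laplace_expansion_column[OF B]) simp
  also have "\<dots> = ?B $$ (0, 0) * cofactor ?B 0 0 + ?B $$ (1, 0) * cofactor ?B 1 0"
    by (simp add: lessThan_nat_numeral lessThan_Suc)
  finally show ?thesis
    using sub[of 0] sub[of 1] by (simp add: minor_def cofactor_def mat_of_cols_index)
qed

lemma pluecker: "minor A i k * minor A j l = minor A i j * minor A k l + minor A i l * minor A j k"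
  unfolding minor_eq by (simp add: algebra_simps)

text \<open>
  For four columns with equal minors, the product on the left of the Pluecker relation would be equal
  to each of the two products on the right, hence to zero.
\<close>

lemma no_four_equal_minors:
  assumes "finite K" and "c \<noteq> 0"
    and eq: "\<And>i j. i \<in> K \<Longrightarrow> j \<in> K \<Longrightarrow> i < j \<Longrightarrow> minor A i j = c"
  shows "card K \<le> 3"
proof (rule ccontr)
  assume "\<not> card K \<le> 3"
  then have len: "4 \<le> length (sorted_list_of_set K)" using assms(1) by simp
  define f where "f t = sorted_list_of_set K ! t" for t
  have f: "f s < f t" if "s < t" "t < 4" for s t
    using that len strict_sorted_list_of_set[of K]
    unfolding f_def by (intro sorted_wrt_nth_less[of "(<)"]) auto
  have fK: "f t \<in> K" if "t < 4" for t
    using that len assms(1) unfolding f_def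
    by (metis less_le_trans nth_mem set_sorted_list_of_set)
  have m: "minor A (f s) (f t) = c" if "s < t" "t < 4" for s t
    using eq[of "f s" "f t"] f fK that by simp
  have "c * c = c * c + c * c"
    using pluecker[of A "f 0" "f 2" "f 1" "f 3"] by (simp add: m)
  then show False using assms(2) by simp
qed

lemma card_equal_minors_le:
  assumes E: "E \<subseteq> {{i, j} | i j. 1 \<le> i \<and> i < j \<and> j \<le> n}" and "c \<noteq> 0"
    and eq: "\<And>i j. i < j \<Longrightarrow> {i, j} \<in> E \<Longrightarrow> minor A i j = c"
  shows "card E \<le> n ^ 2 div 3"
proof -
  have "2 * real 3 * real (card E) \<le> (real 3 - 1) * real (card {1..n}) ^ 2"
  proof (rule turan)
    show "E \<subseteq> {e. e \<subseteq> {1..n} \<and> card e = 2}" using E by (fastforce simp: card_2_iff)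
    show "card K \<le> 3" if "K \<subseteq> {1..n}" "clique E K" for K
    proof (rule no_four_equal_minors)
      show "finite K" using that(1) finite_subset by blast
      show "minor A i j = c" if "i \<in> K" "j \<in> K" "i < j" for i j
        using that eq[of i j] \<open>clique E K\<close> by (auto simp: clique_def)
    qed fact
  qed simp
  then have "real (3 * card E) \<le> real (n ^ 2)" by simp
  then have "3 * card E \<le> n ^ 2" by (simp only: of_nat_le_iff)
  then show ?thesis by simp
qed

lemma card_smallest_positive_le: "card (smallest_positive n A) \<le> n ^ 2 div 3"
proof (cases "smallest_positive n A = {}")
  case False
  then obtain i j where ij: "1 \<le> i" "i < j" "j \<le> n" "minor A i j > 0"
    "\<And>a b. 1 \<le> a \<Longrightarrow> a < b \<Longrightarrow> b \<le> n \<Longrightarrow> minor A a b > 0 \<Longrightarrow> minor A i j \<le> minor A a b"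
    unfolding smallest_positive_def by blast
  show ?thesis
  proof (rule card_equal_minors_le)
    show "minor A i j \<noteq> 0" using ij by simp
    show "minor A a b = minor A i j" if ab: "a < b" "{a, b} \<in> smallest_positive n A" for a b
    proof -
      obtain p q where pq: "{a, b} = {p, q}" "1 \<le> p" "p < q" "q \<le> n" "minor A p q > 0"
        "minor A p q \<le> minor A i j"
        using ab(2) ij(1-4) unfolding smallest_positive_def by blast
      then have "a = p" "b = q" using ab(1) by (auto simp: doubleton_eq_iff)
      then show ?thesis using pq ij(5)[of p q] by simp
    qed
  qed (auto simp: smallest_positive_def)
qed simp

lemma card_largest_positive_le: "card (largest_positive n A) \<le> n ^ 2 div 3"
proof (cases "largest_positive n A = {}")
  case False
  then obtain i j where ij: "1 \<le> i" "i < j" "j \<le> n" "minor A i j > 0"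
    "\<And>a b. 1 \<le> a \<Longrightarrow> a < b \<Longrightarrow> b \<le> n \<Longrightarrow> minor A a b > 0 \<Longrightarrow> minor A a b \<le> minor A i j"
    unfolding largest_positive_def by blast
  show ?thesis
  proof (rule card_equal_minors_le)
    show "minor A i j \<noteq> 0" using ij by simp
    show "minor A a b = minor A i j" if ab: "a < b" "{a, b} \<in> largest_positive n A" for a b
    proof -
      obtain p q where pq: "{a, b} = {p, q}" "1 \<le> p" "p < q" "q \<le> n" "minor A p q > 0"
        "minor A i j \<le> minor A p q"
        using ab(2) ij(1-4) unfolding largest_positive_def by blast
      then have "a = p" "b = q" using ab(1) by (auto simp: doubleton_eq_iff)
      then show ?thesis using pq ij(5)[of p q] by simp
    qed
  qed (auto simp: largest_positive_def)
qed simp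

section \<open>Representatives of points of the nonnegative Grassmannian\<close>

text \<open>
  Two columns with nonzero determinant are independent, which bounds the rank from below; the
  column space lies in a two-dimensional space, which bounds it from above.
\<close>

lemma full_rank_mats_if_minor:
  assumes A: "A \<in> carrier_mat 2 n" and ij: "1 \<le> i" "i \<le> n" "1 \<le> j" "j \<le> n"
    and "minor A i j \<noteq> 0"
  shows "A \<in> full_rank_mats n"
proof -
  interpret vec_space "TYPE(real)" 2 .
  let ?B = "mat_of_cols 2 [col A (i - 1), col A (j - 1)]"
  have B: "?B \<in> carrier_mat 2 2" by (auto simp: mat_of_cols_def)
  have "rank ?B = 2" using det_rank_iff[OF B] assms(6) by (simp add: minor_def)
  have dist: "distinct (cols ?B)"
    using non_distinct_low_rank[OF B] \<open>rank ?B = 2\<close> by linarith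
  have indpt: "lin_indpt (set (cols ?B))"
    using full_rank_lin_indpt[OF B \<open>rank ?B = 2\<close> dist] .
  have "card (set (cols ?B)) = 2"
    using distinct_card[OF dist] by simp
  have cB: "cols ?B = [col A (i - 1), col A (j - 1)]"
  proof (rule cols_mat_of_cols)
    have "col A k \<in> carrier_vec 2" for k
      using A col_dim[of A k] by (simp only: carrier_matD(1))
    then show "set [col A (i - 1), col A (j - 1)] \<subseteq> carrier_vec 2" by simp
  qed
  have "col A k \<in> set (cols A)" if "k < n" for k
    using A that by (simp add: cols_def)
  then have "set (cols ?B) \<subseteq> set (cols A)"
    unfolding cB using ij by simp
  then have "rank A \<ge> 2"
    using rank_ge_card_indpt[OF A _ indpt] \<open>card (set (cols ?B)) = 2\<close> by simp
  moreover have "rank A \<le> 2"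
  proof -
    have "set (cols A) \<subseteq> carrier_vec 2" using cols_dim[of A] A by (simp only: carrier_matD(1))
    then have "subspace class_ring (span (set (cols A))) V"
      using span_is_subspace by metis
    from subspace_dim[OF this fin_dim fin_dim_span_cols[OF A]]
    show ?thesis by (simp only: rank_def dim_is_n)
  qed
  ultimately show ?thesis using A by (simp add: full_rank_mats_def)
qed

lemma row_equiv_refl: "A \<in> full_rank_mats n \<Longrightarrow> (A, A) \<in> row_equiv n"
  unfolding row_equiv_def full_rank_mats_def
  by (auto intro!: bexI[of _ "1\<^sub>m 2"] exI[of _ "1\<^sub>m 2"]
      simp: invertible_mat_def inverts_mat_def)

lemma Gr2_nonneg_representative:
  assumes "A \<in> full_rank_mats n" "nonneg_minors n A"
  obtains V where "V \<in> Gr2_nonneg n" "A \<in> V"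
  using assms row_equiv_refl[OF assms(1)]
  unfolding Gr2_nonneg_def Gr2_def by (auto intro: quotientI)

section \<open>Three blocks of equal columns\<close>

text \<open>
  The blocks have \<open>(n + 2) div 3\<close>, \<open>(n + 1) div 3\<close> and \<open>n div 3\<close> columns. These numbers have sum
  \<open>n\<close> and differ by at most one, as Turan's extremal graph requires.
\<close>

definition end1 :: "nat \<Rightarrow> nat" where "end1 n = (n + 2) div 3"
definition end2 :: "nat \<Rightarrow> nat" where "end2 n = (n + 2) div 3 + (n + 1) div 3"

definition block_mat :: "nat \<Rightarrow> real mat" where
  "block_mat n = mat 2 n (\<lambda>(r, c).
     if c < end1 n then (if r = 0 then 1 else 0)
     else if c < end2 n then (if r = 0 then 0 else 1)
     else (if r = 0 then -1 else 1))"

text \<open>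
  Here columns are numbered from 1, so that a block contains its end, whereas the column index \<open>c\<close>
  of \<open>block_mat\<close> starts from 0.
\<close>

definition same_block :: "nat \<Rightarrow> nat \<Rightarrow> nat \<Rightarrow> bool" where
  "same_block n i j \<longleftrightarrow> (i \<le> end1 n \<longleftrightarrow> j \<le> end1 n) \<and> (i \<le> end2 n \<longleftrightarrow> j \<le> end2 n)"

lemma minor_block_mat:
  assumes "1 \<le> i" "i < j" "j \<le> n"
  shows "minor (block_mat n) i j = (if same_block n i j then 0 else 1)"
proof -
  have "end1 n \<le> end2 n" by (simp add: end1_def end2_def)
  then show ?thesis
    using assms unfolding minor_eq by (auto simp: block_mat_def same_block_def)
qed

lemma block_mat_representative:
  assumes "n \<ge> 2"
  obtains V where "V \<in> Gr2_nonneg n" "block_mat n \<in> V" "nonneg_minors n (block_mat n)"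
proof -
  have nn: "nonneg_minors n (block_mat n)"
    by (simp add: nonneg_minors_def minor_block_mat)
  \<comment> \<open>For \<open>n \<ge> 2\<close> the last column lies outside the first block.\<close>
  have "minor (block_mat n) 1 n \<noteq> 0"
    using assms by (auto simp: minor_block_mat same_block_def end1_def)
  then have "block_mat n \<in> full_rank_mats n"
    using assms by (intro full_rank_mats_if_minor[of _ _ 1 n]) (auto simp: block_mat_def)
  then show ?thesis using that nn Gr2_nonneg_representative by blast
qed

definition tripartite :: "nat \<Rightarrow> nat set set" where
  "tripartite n = {{i, j} | i j. 1 \<le> i \<and> i < j \<and> j \<le> n \<and> \<not> same_block n i j}"

lemma smallest_positive_block_mat: "smallest_positive n (block_mat n) = tripartite n"
proof -
  have "(1 \<le> i \<and> i < j \<and> j \<le> n \<and> minor (block_mat n) i j > 0 \<and>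
     (\<forall>a b. 1 \<le> a \<and> a < b \<and> b \<le> n \<and> minor (block_mat n) a b > 0
        \<longrightarrow> minor (block_mat n) i j \<le> minor (block_mat n) a b))
    \<longleftrightarrow> 1 \<le> i \<and> i < j \<and> j \<le> n \<and> \<not> same_block n i j" for i j
    by (auto simp: minor_block_mat)
  then show ?thesis unfolding smallest_positive_def tripartite_def by simp
qed

lemma largest_positive_block_mat: "largest_positive n (block_mat n) = tripartite n"
proof -
  have "(1 \<le> i \<and> i < j \<and> j \<le> n \<and> minor (block_mat n) i j > 0 \<and>
     (\<forall>a b. 1 \<le> a \<and> a < b \<and> b \<le> n \<and> minor (block_mat n) a b > 0
        \<longrightarrow> minor (block_mat n) a b \<le> minor (block_mat n) i j))
    \<longleftrightarrow> 1 \<le> i \<and> i < j \<and> j \<le> n \<and> \<not> same_block n i j" for i j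
    by (auto simp: minor_block_mat)
  then show ?thesis unfolding largest_positive_def tripartite_def by simp
qed

lemma square_div_3:
  fixes m :: nat
  shows "(3 * m) ^ 2 div 3 = 3 * m ^ 2"
    and "(3 * m + 1) ^ 2 div 3 = m * (3 * m + 2)"
    and "(3 * m + 2) ^ 2 div 3 = (m + 1) * (3 * m + 1)"
proof -
  show "(3 * m) ^ 2 div 3 = 3 * m ^ 2" by (simp add: power2_eq_square)
  have "(3 * m + 1) ^ 2 = 1 + 3 * (m * (3 * m + 2))"
    by (simp add: power2_eq_square algebra_simps)
  then show "(3 * m + 1) ^ 2 div 3 = m * (3 * m + 2)" by presburger
  have "(3 * m + 2) ^ 2 = 1 + 3 * ((m + 1) * (3 * m + 1))"
    by (simp add: power2_eq_square algebra_simps)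
  then show "(3 * m + 2) ^ 2 div 3 = (m + 1) * (3 * m + 1)" by presburger
qed

lemma card_tripartite_ge: "n ^ 2 div 3 \<le> card (tripartite n)"
proof -
  let ?p = "end1 n" and ?q = "end2 n"
  \<comment> \<open>The first product joins the first block to the two others, the second one joins these two.\<close>
  define P where "P = {1..?p} \<times> {?p<..n} \<union> {?p<..?q} \<times> {?q<..n}"
  have pq: "?p \<le> ?q" "?q \<le> n" unfolding end1_def end2_def by presburger+
  have "inj_on (\<lambda>(i, j). {i, j}) P"
    using pq by (auto simp: P_def inj_on_def doubleton_eq_iff)
  moreover have "(\<lambda>(i, j). {i, j}) ` P \<subseteq> tripartite n"
    using pq by (fastforce simp: P_def tripartite_def same_block_def)
  moreover have "finite (tripartite n)"
    by (rule finite_subset[of _ "Pow {1..n}"]) (auto simp: tripartite_def)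
  ultimately have "card P \<le> card (tripartite n)"
    by (rule card_inj_on_le)
  moreover have "card P = ?p * (n - ?p) + (?q - ?p) * (n - ?q)"
    unfolding P_def by (subst card_Un_disjoint) (auto simp: card_cartesian_product)
  moreover have "\<dots> = n ^ 2 div 3"
  proof -
    define m where "m = n div 3"
    consider "n = 3 * m" | "n = 3 * m + 1" | "n = 3 * m + 2" unfolding m_def by linarith
    then show ?thesis
    proof cases
      case 1
      then have "?p = m" "?q = 2 * m" unfolding end1_def end2_def by presburger+
      then show ?thesis using 1 square_div_3(1)[of m] by (simp add: power2_eq_square)
    next
      case 2
      then have "?p = m + 1" "?q = 2 * m + 1" unfolding end1_def end2_def by presburger+
      then show ?thesis using 2 square_div_3(2)[of m] by (simp add: algebra_simps)
    next
      case 3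
      then have "?p = m + 1" "?q = 2 * m + 2" unfolding end1_def end2_def by presburger+
      then show ?thesis using 3 square_div_3(3)[of m] by (simp add: algebra_simps)
    qed
  qed
  ultimately show ?thesis by simp
qed

section \<open>Maximal arrangements\<close>

lemma maximal_by_size_card:
  assumes "J\<^sub>0 \<in> \<A>" "N \<le> card J\<^sub>0" "\<And>J. J \<in> \<A> \<Longrightarrow> card J \<le> N"
  shows "(\<exists>J. maximal_by_size \<A> J) \<and> (\<forall>J. maximal_by_size \<A> J \<longrightarrow> card J = N)"
  using assms unfolding maximal_by_size_def by (meson le_antisym le_trans)

theorem theorem11p2:
  fixes n :: nat
  assumes "n \<ge> 2"
  shows "\<forall>\<A> \<in> {smallest_arrangements n, largest_arrangements n}.
    (\<exists>J. maximal_by_size \<A> J) \<and>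
    (\<forall>J. maximal_by_size \<A> J \<longrightarrow>
      (\<forall>m. (n = 3 * m \<longrightarrow> card J = 3 * m ^ 2) \<and>
           (n = 3 * m + 1 \<longrightarrow> card J = m * (3 * m + 2)) \<and>
           (n = 3 * m + 2 \<longrightarrow> card J = (m + 1) * (3 * m + 1))))"
proof
  fix \<A> assume \<A>: "\<A> \<in> {smallest_arrangements n, largest_arrangements n}"
  obtain V where V: "V \<in> Gr2_nonneg n" "block_mat n \<in> V" "nonneg_minors n (block_mat n)"
    using block_mat_representative[OF assms] .
  have "tripartite n \<in> smallest_arrangements n"
    unfolding smallest_arrangements_def using V smallest_positive_block_mat by blast
  moreover have "tripartite n \<in> largest_arrangements n"
    unfolding largest_arrangements_def using V largest_positive_block_mat by blast
  ultimately have "tripartite n \<in> \<A>" using \<A> by blast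
  moreover have "card J \<le> n ^ 2 div 3" if "J \<in> \<A>" for J
    using that \<A> card_smallest_positive_le card_largest_positive_le
    by (auto simp: smallest_arrangements_def largest_arrangements_def)
  ultimately have "(\<exists>J. maximal_by_size \<A> J) \<and> (\<forall>J. maximal_by_size \<A> J \<longrightarrow> card J = n ^ 2 div 3)"
    using card_tripartite_ge by (intro maximal_by_size_card)
  then show "(\<exists>J. maximal_by_size \<A> J) \<and>
    (\<forall>J. maximal_by_size \<A> J \<longrightarrow>
      (\<forall>m. (n = 3 * m \<longrightarrow> card J = 3 * m ^ 2) \<and>
           (n = 3 * m + 1 \<longrightarrow> card J = m * (3 * m + 2)) \<and>
           (n = 3 * m + 2 \<longrightarrow> card J = (m + 1) * (3 * m + 1))))"
    by (metis square_div_3)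
qed

end
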